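(* Let $(E,\|\cdot\|)$ be a normed vector space. For $\ell>0$, $C_1,C_2\ge0$ and $\eta\in(0,1)$, let $\mathcal R(\eta,\ell,C_1,C_2)$ be the set of functions $f:[0,1]\to E$ such that $f$ is bounded, $f_0=0$, and for any $s\le t$ in $[0,1]$ with $t-s\le\ell$, $$\|f_t-f_s\|\le C_1\big(\|f\|_{L^\infty_{[s,t]}E}+\eta\big)(t-s)^{\frac12}+C_2\big(\|f\|_{L^\infty_{[s,t]}E}+\eta\big)\Big|\log\big(\|f\|_{L^\infty_{[s,t]}E}+\eta\big)\Big|(t-s).$$ Then for any $\delta\in(0,e^{-C_2})$, there exists $\bar\eta\equiv\bar\eta(C_1,C_2,\ell,\delta)>0$ such that for any $\eta<\bar\eta$ and any $f\in\mathcal R(\eta,\ell,C_1,C_2)$, $$\|f\|_{L^\infty_{[0,1]}E}\le\eta^{\,e^{-C_2}-\delta}.$$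
   Context: $\|f\|_{L^\infty_{[s,t]}E}=\sup_{r\in[s,t]}\|f_r\|$. *)

theory Defs
  imports "HOL-Analysis.Analysis"
begin

definition sup_norm_on :: "real \<Rightarrow> real \<Rightarrow> (real \<Rightarrow> 'a::real_normed_vector) \<Rightarrow> real" where
  "sup_norm_on s t f = (SUP r\<in>{s..t}. norm (f r))"

text \<open>A function on \<open>[0,1]\<close> is represented by a function on all reals; only its values on
  \<open>[0,1]\<close> are constrained. The suprema below are over nonempty bounded sets, because
  \<open>s \<le> t\<close> and \<open>f\<close> is bounded on \<open>[0,1]\<close>.\<close>

definition R_class :: "real \<Rightarrow> real \<Rightarrow> real \<Rightarrow> real \<Rightarrow> (real \<Rightarrow> 'a::real_normed_vector) set" where
  "R_class \<eta> l C1 C2 =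
    {f. bounded (f ` {0..1}) \<and> f 0 = 0 \<and>
        (\<forall>s\<in>{0..1}. \<forall>t\<in>{0..1}. s \<le> t \<and> t - s \<le> l \<longrightarrow>
          norm (f t - f s)
            \<le> C1 * (sup_norm_on s t f + \<eta>) * (t - s) powr (1/2)
              + C2 * (sup_norm_on s t f + \<eta>) * \<bar>ln (sup_norm_on s t f + \<eta>)\<bar> * (t - s))}"

end

theory Submission
  imports Defs "HOL-Real_Asymp.Real_Asymp"
begin

text \<open>Put \<open>L = - ln (norm f + \<eta>)\<close> and \<open>\<Lambda> = - ln \<eta>\<close>. The \<open>C2\<close> term
  alone gives \<open>L' \<ge> - C2 * L\<close>, hence \<open>L 1 \<ge> exp (- C2) * \<Lambda>\<close>. On a grid of mesh
  \<open>h = 1/N\<close> the \<open>C1\<close> term costs \<open>O (sqrt h)\<close> per step, so \<open>O (sqrt N)\<close> in total, while the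
  linearisation is accurate as soon as \<open>h * \<Lambda>\<close> is small. With \<open>N\<close> of order
  \<open>\<Lambda> powr (3/2)\<close> all errors are \<open>o(\<Lambda>)\<close> and are absorbed by \<open>\<delta> * \<Lambda>\<close>.
  The argument needs \<open>norm f + \<eta> \<le> 1\<close>; since \<open>f\<close> is continuous, it can be run up to the first
  time at which equality holds, and its conclusion shows that there is no such time.\<close>

section \<open>Suprema of norms over subintervals, and continuity of members of the class\<close>

lemma bdd_above_norm_image:
  fixes f :: "real \<Rightarrow> 'a::real_normed_vector"
  assumes "bounded (f ` A)" "B \<subseteq> A"
  shows "bdd_above ((\<lambda>r. norm (f r)) ` B)"
proof -
  obtain K where "\<forall>x\<in>f ` A. norm x \<le> K"
    using assms(1) by (auto simp: bounded_iff)
  then show ?thesis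
    using assms(2) by (auto intro!: bdd_aboveI[of _ K])
qed

lemma norm_le_sup_norm_on:
  assumes "bounded (f ` A)" "{s..t} \<subseteq> A" "r \<in> {s..t}"
  shows "norm (f r) \<le> sup_norm_on s t f"
  unfolding sup_norm_on_def
  by (intro cSUP_upper assms(3) bdd_above_norm_image[OF assms(1,2)])

lemma sup_norm_on_le:
  assumes "s \<le> t" "\<And>r. r \<in> {s..t} \<Longrightarrow> norm (f r) \<le> K"
  shows "sup_norm_on s t f \<le> K"
  unfolding sup_norm_on_def using assms by (intro cSUP_least) auto

lemma R_class_bounded: "f \<in> R_class \<eta> l C1 C2 \<Longrightarrow> bounded (f ` {0..1})"
  and R_class_zero: "f \<in> R_class \<eta> l C1 C2 \<Longrightarrow> f 0 = 0"
  by (auto simp: R_class_def)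

lemma R_class_increment:
  assumes "f \<in> R_class \<eta> l C1 C2" "0 \<le> s" "s \<le> t" "t \<le> 1" "t - s \<le> l"
  shows "norm (f t - f s) \<le> C1 * (sup_norm_on s t f + \<eta>) * sqrt (t - s)
           + C2 * (sup_norm_on s t f + \<eta>) * \<bar>ln (sup_norm_on s t f + \<eta>)\<bar> * (t - s)"
  using assms by (auto simp: R_class_def powr_half_sqrt)

text \<open>Since \<eta> > 0, the quantity under the logarithm stays in a compact subinterval of the
  positive reals. The increment bound therefore gives a modulus of continuity independent of the
  interval.\<close>

lemma R_class_continuous_on:
  assumes f: "f \<in> R_class \<eta> l C1 C2" and pos: "0 < \<eta>" "0 < l" "0 \<le> C1" "0 \<le> C2"
  shows "continuous_on {0..1} f"
proof -
  obtain B where B: "\<And>r. r \<in> {0..1} \<Longrightarrow> norm (f r) \<le> B"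
    using R_class_bounded[OF f] unfolding bounded_iff by blast
  have "0 \<le> B"
    using B[of 0] by (simp add: R_class_zero[OF f])
  define K where "K = B + \<eta>"
  \<comment> \<open>\<open>ln m\<close> lies between \<open>ln \<eta>\<close> and
    \<open>ln K\<close>, whose signs are unknown; hence the sum of both absolute values.\<close>
  define D where "D = \<bar>ln \<eta>\<bar> + \<bar>ln K\<bar>"
  have est: "norm (f t - f s) \<le> C1 * K * sqrt (t - s) + C2 * K * D * (t - s)"
    if st: "0 \<le> s" "s \<le> t" "t \<le> 1" "t - s \<le> l" for s t
  proof -
    define m where "m = sup_norm_on s t f + \<eta>"
    have "norm (f s) \<le> sup_norm_on s t f"
      using st by (intro norm_le_sup_norm_on[OF R_class_bounded[OF f]]) auto
    then have "0 \<le> sup_norm_on s t f"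
      using norm_ge_zero[of "f s"] by linarith
    then have m1: "\<eta> \<le> m"
      by (simp add: m_def)
    have "sup_norm_on s t f \<le> B"
      using st by (intro sup_norm_on_le B) auto
    then have m2: "m \<le> K"
      by (simp add: m_def K_def)
    have "ln \<eta> \<le> ln m" "ln m \<le> ln K"
      using m1 m2 pos by auto
    then have lnm: "\<bar>ln m\<bar> \<le> D"
      by (auto simp: D_def)
    have "norm (f t - f s) \<le> C1 * m * sqrt (t - s) + C2 * m * \<bar>ln m\<bar> * (t - s)"
      using R_class_increment[OF f st] by (simp add: m_def)
    also have "\<dots> \<le> C1 * K * sqrt (t - s) + C2 * K * D * (t - s)"
      using m1 m2 lnm pos st by (intro add_mono mult_mono) auto
    finally show ?thesis .
  qed
  show ?thesis
    unfolding continuous_on_def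
  proof
    fix x :: real assume x: "x \<in> {0..1}"
    define g where "g t = C1 * K * sqrt \<bar>t - x\<bar> + C2 * K * D * \<bar>t - x\<bar>" for t
    have "(g \<longlongrightarrow> C1 * K * sqrt \<bar>x - x\<bar> + C2 * K * D * \<bar>x - x\<bar>) (at x within {0..1})"
      unfolding g_def by (intro tendsto_intros)
    then have g: "(g \<longlongrightarrow> 0) (at x within {0..1})"
      by simp
    have "\<forall>\<^sub>F t in at x within {0..1}. norm (f t - f x) \<le> g t"
      unfolding eventually_at
    proof (intro exI[of _ l] conjI ballI impI)
      fix t assume t: "t \<in> {0..1}" "t \<noteq> x \<and> dist t x < l"
      show "norm (f t - f x) \<le> g t"
      proof (cases "x \<le> t")
        case True
        then show ?thesis
          using est[of x t] t x by (simp add: g_def dist_real_def)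
      next
        case False
        then show ?thesis
          using est[of t x] t x by (simp add: g_def dist_real_def norm_minus_commute abs_minus_commute)
      qed
    qed (fact pos(2))
    then have "((\<lambda>t. f t - f x) \<longlongrightarrow> 0) (at x within {0..1})"
      using g by (rule Lim_null_comparison)
    then show "(f \<longlongrightarrow> f x) (at x within {0..1})"
      by (simp add: LIM_zero_iff)
  qed
qed

section \<open>Growth on one grid cell and its iteration\<close>

text \<open>With \<open>A = exp (- L)\<close> and \<open>M\<close> the supremum on the cell,
  linearising the logarithmic term at \<open>A\<close> gives
  \<open>M \<le> A * (1 + C2 * h) + M * q\<close>. The term \<open>M * q\<close> is absorbed on the
  left, and taking logarithms costs \<open>C2 * h\<close> for the first factor and
  \<open>q + 2 * q^2\<close> for \<open>1 - q\<close>.\<close>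

lemma R_class_growth_step:
  assumes f: "f \<in> R_class \<eta> l C1 C2" and pos: "0 < \<eta>" "0 \<le> C1" "0 \<le> C2"
    and ab: "0 \<le> a" "b \<le> 1" "b - a \<le> h" "h \<le> l"
    and le_one: "\<And>r. r \<in> {a..b} \<Longrightarrow> norm (f r) + \<eta> \<le> 1"
    and start: "norm (f a) + \<eta> \<le> exp (- L)" and L: "0 \<le> L"
    and q: "q = C1 * sqrt h + C2 * h * L" "q \<le> 1/2"
    and r: "r \<in> {a..b}"
  shows "norm (f r) + \<eta> \<le> exp (- (L - C2 * h - q - 2 * q\<^sup>2))"
proof -
  define A where "A = exp (- L)"
  define M where "M = sup_norm_on a b f + \<eta>"
  have "a \<le> b" "0 \<le> h"
    using r ab by auto
  have "0 \<le> q"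
    using pos L \<open>0 \<le> h\<close> by (simp add: q)
  note bd = R_class_bounded[OF f]
  have M_ge: "norm (f x) + \<eta> \<le> M" if "x \<in> {a..b}" for x
    using norm_le_sup_norm_on[OF bd _ that] ab by (simp add: M_def)
  have step: "norm (f x) \<le> A * (1 + C2 * h) + M * q - \<eta>" if x: "x \<in> {a..b}" for x
  proof -
    define m where "m = sup_norm_on a x f + \<eta>"
    have "norm (f a) \<le> sup_norm_on a x f"
      using x ab by (intro norm_le_sup_norm_on[OF bd]) auto
    then have m1: "\<eta> \<le> m"
      unfolding m_def using norm_ge_zero[of "f a"] by linarith
    have "sup_norm_on a x f \<le> M - \<eta>"
      using x M_ge by (intro sup_norm_on_le) (auto simp: le_diff_eq)
    then have m2: "m \<le> M"
      by (simp add: m_def)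
    \<comment> \<open>This is where \<open>le_one\<close> enters: \<open>m \<le> 1\<close> turns
      \<open>\<bar>ln m\<bar>\<close> into \<open>- ln m\<close>.\<close>
    have "sup_norm_on a x f \<le> 1 - \<eta>"
      using x le_one by (intro sup_norm_on_le) (auto simp: le_diff_eq)
    then have m3: "m \<le> 1"
      by (simp add: m_def)
    have "0 < m"
      using m1 pos by simp
    \<comment> \<open>The concave function \<open>- x * ln x\<close> lies below its tangent at \<open>A\<close>; unlike monotonicity,
      this needs no upper bound \<open>1/e\<close> on \<open>m\<close>.\<close>
    have "ln (A / m) \<le> A / m - 1"
      using \<open>0 < m\<close> by (intro ln_le_minus_one) (simp add: A_def)
    moreover have "ln (A / m) = - L - ln m"
      using \<open>0 < m\<close> by (simp add: A_def ln_div)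
    ultimately have "m * (- L - ln m) \<le> m * (A / m - 1)"
      using \<open>0 < m\<close> by (intro mult_left_mono) auto
    also have "\<dots> = A - m"
      using \<open>0 < m\<close> by (simp add: field_simps)
    finally have "m * (- ln m) \<le> m * L + A"
      using \<open>0 < m\<close> by (simp add: algebra_simps)
    also have "\<dots> \<le> M * L + A"
      using m2 L by (simp add: mult_right_mono)
    finally have tangent: "m * \<bar>ln m\<bar> \<le> M * L + A"
      using m3 \<open>0 < m\<close> by (simp add: abs_of_nonpos)
    have xh: "0 \<le> x - a" "x - a \<le> h"
      using x ab by auto
    have "norm (f x - f a) \<le> C1 * m * sqrt (x - a) + C2 * m * \<bar>ln m\<bar> * (x - a)"
      unfolding m_def using x ab by (intro R_class_increment[OF f]) auto
    also have "\<dots> = (C1 * m) * sqrt (x - a) + C2 * (m * \<bar>ln m\<bar>) * (x - a)"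
      by simp
    also have "\<dots> \<le> (C1 * M) * sqrt h + C2 * (M * L + A) * h"
      using m2 \<open>0 < m\<close> tangent xh pos L
      by (intro add_mono mult_mono) (auto simp: A_def)
    also have "\<dots> = M * q + A * (C2 * h)"
      by (simp add: q algebra_simps)
    finally show ?thesis
      using start norm_triangle_sub[of "f x" "f a"] by (simp add: A_def algebra_simps)
  qed
  have "sup_norm_on a b f \<le> A * (1 + C2 * h) + M * q - \<eta>"
    using \<open>a \<le> b\<close> step by (rule sup_norm_on_le)
  then have "M * (1 - q) \<le> A * (1 + C2 * h)"
    by (simp add: M_def algebra_simps)
  moreover have "1 + C2 * h \<le> exp (C2 * h)"
    by (rule exp_ge_add_one_self)
  ultimately have "M * (1 - q) \<le> A * exp (C2 * h)"
    by (smt (verit) A_def exp_gt_zero mult_left_mono)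
  \<comment> \<open>The restriction \<open>q \<le> 1/2\<close> is what makes this quadratic lower
    bound for \<open>ln (1 - q)\<close> available.\<close>
  moreover have "exp (- q - 2 * q\<^sup>2) \<le> exp (ln (1 - q))"
    using ln_one_minus_pos_lower_bound[of q] \<open>0 \<le> q\<close> q(2) by (simp only: exp_le_cancel_iff)
  then have "exp (- q - 2 * q\<^sup>2) \<le> 1 - q"
    using q(2) by simp
  moreover have "0 \<le> M"
    using M_ge[OF r] pos norm_ge_zero[of "f r"] by linarith
  ultimately have "M * exp (- q - 2 * q\<^sup>2) \<le> A * exp (C2 * h)"
    by (meson mult_left_mono order_trans)
  then have "M * exp (- q - 2 * q\<^sup>2) * exp (q + 2 * q\<^sup>2) \<le> A * exp (C2 * h) * exp (q + 2 * q\<^sup>2)"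
    by (rule mult_right_mono) simp
  then have "M \<le> exp (- (L - C2 * h - q - 2 * q\<^sup>2))"
    by (simp add: A_def mult.assoc flip: exp_add) (simp add: algebra_simps)
  then show ?thesis
    using M_ge[OF r] by linarith
qed

text \<open>Each cell multiplies the exponent by \<open>1 - C2 / N\<close>, up to a loss of at most
  \<open>E\<close>. \<open>L\<close> is a closed form below the solution of this recursion, as it
  ignores the damping of earlier losses. The cells have length \<open>\<tau> / N\<close>, at most
  \<open>1 / N\<close>, so the conditions on \<open>N\<close> do not involve
  \<open>\<tau>\<close>.\<close>

lemma R_class_growth:
  fixes N :: nat and \<tau> \<eta> C1 C2 :: real
  defines "\<Lambda> \<equiv> - ln \<eta>"
  defines "Q \<equiv> C1 * sqrt (1 / N) + C2 / N * \<Lambda>"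
  defines "E \<equiv> C1 * sqrt (1 / N) + C2 / N + 2 * Q\<^sup>2"
  defines "L \<equiv> \<lambda>i. (1 - C2 / N) ^ i * \<Lambda> - i * E"
  assumes f: "f \<in> R_class \<eta> l C1 C2" and pos: "0 < \<eta>" "\<eta> < 1" "0 \<le> C1" "0 \<le> C2"
    and tau: "0 \<le> \<tau>" "\<tau> \<le> 1"
    and le_one: "\<And>r. r \<in> {0..\<tau>} \<Longrightarrow> norm (f r) + \<eta> \<le> 1"
    and N: "0 < N" "1 / N \<le> l" "C2 / N \<le> 1" and Q: "Q \<le> 1/2" and LN: "0 \<le> L N"
    and r: "r \<in> {0..\<tau>}"
  shows "norm (f r) + \<eta> \<le> exp (- L N)"
proof -
  define c where "c = C2 / N"
  have c: "0 \<le> c" "c \<le> 1"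
    using pos N by (auto simp: c_def)
  have Lam: "0 < \<Lambda>"
    using pos by (simp add: \<Lambda>_def)
  have Q0: "0 \<le> Q"
    unfolding Q_def using Lam pos by simp
  have E0: "0 \<le> E"
    unfolding E_def using pos Q0 by simp
  have L_antimono: "L j \<le> L i" if "i \<le> j" for i j
  proof -
    have "(1 - c) ^ j \<le> (1 - c) ^ i"
      using c that by (intro power_decreasing) auto
    moreover have "i * E \<le> j * E"
      using that E0 by (intro mult_right_mono) auto
    ultimately show ?thesis
      unfolding L_def c_def using Lam by (intro diff_mono mult_right_mono[where c = \<Lambda>]) auto
  qed
  \<comment> \<open>The claim covers the whole initial interval, not just grid points, so the case
    \<open>i = N\<close> is already the conclusion.\<close>
  have "\<forall>r\<in>{0..i * \<tau> / N}. norm (f r) + \<eta> \<le> exp (- L i)" if "i \<le> N" for i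
    using that
  proof (induction i)
    case 0
    then show ?case
      using pos by (simp add: R_class_zero[OF f] L_def \<Lambda>_def)
  next
    case (Suc i)
    show ?case
    proof
      fix r assume r: "r \<in> {0..Suc i * \<tau> / N}"
      have IH: "norm (f r) + \<eta> \<le> exp (- L i)" if "r \<in> {0..i * \<tau> / N}" for r
        using Suc that by auto
      show "norm (f r) + \<eta> \<le> exp (- L (Suc i))"
      proof (cases "r \<le> i * \<tau> / N")
        case True
        then have "norm (f r) + \<eta> \<le> exp (- L i)"
          using IH r by auto
        also have "\<dots> \<le> exp (- L (Suc i))"
          using L_antimono[of i "Suc i"] by simp
        finally show ?thesis .
      next
        case False
        define q where "q = C1 * sqrt (1 / N) + C2 * (1 / N) * L i"
        \<comment> \<open>The one-step estimate needs a nonnegative exponent; as \<open>L\<close>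
          decreases, the hypothesis at \<open>N\<close> supplies it at every stage.\<close>
        have Li0: "0 \<le> L i"
          using LN L_antimono[of i N] Suc.prems by simp
        have "L i \<le> \<Lambda>"
          using L_antimono[of 0 i] by (simp add: L_def)
        then have "c * L i \<le> c * \<Lambda>"
          using c by (intro mult_left_mono)
        then have qQ: "q \<le> Q"
          by (simp add: q_def Q_def c_def)
        have q0: "0 \<le> q"
          using pos Li0 by (simp add: q_def)
        have "Suc i * \<tau> \<le> N * \<tau>"
          using Suc.prems tau by (intro mult_right_mono) auto
        then have end_le: "Suc i * \<tau> / N \<le> \<tau>"
          using N by (simp add: field_simps)
        have "norm (f r) + \<eta> \<le> exp (- (L i - C2 * (1 / N) - q - 2 * q\<^sup>2))"
        proof (rule R_class_growth_step[OF f pos(1,3,4), where a = "i * \<tau> / N"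
              and b = "Suc i * \<tau> / N"])
          show "Suc i * \<tau> / N - i * \<tau> / N \<le> 1 / N"
            using N tau by (simp add: field_simps)
          show "norm (f x) + \<eta> \<le> 1" if "x \<in> {i * \<tau> / N..Suc i * \<tau> / N}" for x
          proof (rule le_one)
            have "0 \<le> i * \<tau> / N"
              using tau by simp
            then show "x \<in> {0..\<tau>}"
              using that end_le by (simp only: atLeastAtMost_iff) linarith
          qed
          show "norm (f (i * \<tau> / N)) + \<eta> \<le> exp (- L i)"
            using tau by (intro IH) auto
          show "Suc i * \<tau> / N \<le> 1"
            using end_le tau by linarith
          show "q \<le> 1 / 2"
            using qQ Q by simp
        qed (use tau N q_def Li0 False r in auto)
        also have "L (Suc i) \<le> L i - C2 * (1 / N) - q - 2 * q\<^sup>2"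
        proof -
          have "q\<^sup>2 \<le> Q\<^sup>2"
            using qQ q0 by (rule power_mono)
          moreover have "0 \<le> c * (i * E)"
            using c E0 by simp
          moreover have "L (Suc i) = L i - c * L i - c * (i * E) - E"
            by (simp add: L_def c_def algebra_simps)
          moreover have "q = C1 * sqrt (1 / N) + c * L i"
            by (simp add: q_def c_def)
          moreover have "E = C1 * sqrt (1 / N) + c + 2 * Q\<^sup>2"
            by (simp add: E_def c_def)
          moreover have "C2 * (1 / N) = c"
            by (simp add: c_def)
          ultimately show ?thesis
            by linarith
        qed
        then have "exp (- (L i - C2 * (1 / N) - q - 2 * q\<^sup>2)) \<le> exp (- L (Suc i))"
          by simp
        finally show ?thesis .
      qed
    qed
  qed
  from this[of N] show ?thesis
    using N r by simp
qed

section \<open>Choice of the mesh\<close>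

text \<open>For \<open>N\<close> of order \<open>\<Lambda> powr p\<close>, the accumulated
  square-root error has order \<open>\<Lambda> powr (p/2)\<close> and the quadratic one at most
  order \<open>1 + \<Lambda> powr (p/2) + \<Lambda> powr (2 - p)\<close>. Both are
  \<open>o(\<Lambda>)\<close> for 1 < p < 2; the proof takes \<open>p = 3/2\<close>.\<close>

lemma eventually_grid_size:
  fixes l C1 C2 \<delta> :: real
  assumes "0 < l" "0 < \<delta>"
  shows "\<forall>\<^sub>F \<Lambda> in at_top. \<exists>N::nat. 0 < N \<and> 1 / N \<le> l \<and> C2 / N \<le> 1
    \<and> C1 * sqrt (1 / N) + C2 / N * \<Lambda> \<le> 1 / 2
    \<and> (exp (- C2) - \<delta>) * \<Lambda> \<le> (1 - C2 / N) ^ N * \<Lambda>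
        - N * (C1 * sqrt (1 / N) + C2 / N + 2 * (C1 * sqrt (1 / N) + C2 / N * \<Lambda>)\<^sup>2)"
proof -
  define N :: "real \<Rightarrow> nat" where "N x = nat \<lceil>x powr (3/2)\<rceil>" for x
  have N_top: "filterlim N at_top at_top"
    unfolding N_def by real_asymp
  have lims: "((\<lambda>x. 1 / real (N x)) \<longlongrightarrow> 0) at_top"
    "((\<lambda>x. sqrt (1 / real (N x))) \<longlongrightarrow> 0) at_top"
    "((\<lambda>x. x / real (N x)) \<longlongrightarrow> 0) at_top"
    "((\<lambda>x. real (N x) * sqrt (1 / real (N x)) / x) \<longlongrightarrow> 0) at_top"
    "((\<lambda>x. sqrt (real (N x) / x) * sqrt (1 / real (N x))) \<longlongrightarrow> 0) at_top"
    "((\<lambda>x. sqrt (real (N x) / x) * (x / real (N x))) \<longlongrightarrow> 0) at_top"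
    unfolding N_def by real_asymp+
  have exp_lim: "((\<lambda>x. (1 + (- C2) / real (N x)) ^ N x) \<longlongrightarrow> exp (- C2)) at_top"
    using filterlim_compose[OF tendsto_exp_limit_sequentially N_top] .
  define Q where "Q x = C1 * sqrt (1 / N x) + C2 / N x * x" for x
  define err where "err x = N x * (C1 * sqrt (1 / N x) + C2 / N x + 2 * (Q x)\<^sup>2) / x" for x
  have C2_lim: "((\<lambda>x. C2 / real (N x)) \<longlongrightarrow> 0) at_top"
    using tendsto_mult_right_zero[OF lims(1), of C2] by simp
  have Q_lim: "(Q \<longlongrightarrow> 0) at_top"
    using tendsto_add[OF tendsto_mult_right_zero[OF lims(2), of C1]
        tendsto_mult_right_zero[OF lims(3), of C2]]
    by (simp add: Q_def[abs_def])
  have N_pos: "\<forall>\<^sub>F x in at_top. 0 < N x"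
    using eventually_compose_filterlim[OF eventually_gt_at_top N_top] .
  have ev: "\<forall>\<^sub>F x in at_top. 0 < x \<and> 0 < N x"
    by (intro eventually_conj eventually_gt_at_top N_pos)
  \<comment> \<open>This is \<open>err\<close> rearranged: \<open>N * Q^2 / x\<close> is the square
    of \<open>sqrt (N / x) * Q\<close>, and the last two limits in \<open>lims\<close> treat the two
    summands of \<open>Q\<close>.\<close>
  have "((\<lambda>x. C1 * (N x * sqrt (1 / N x) / x) + C2 * (1 / x)
      + 2 * (C1 * (sqrt (N x / x) * sqrt (1 / N x)) + C2 * (sqrt (N x / x) * (x / N x)))\<^sup>2)
      \<longlongrightarrow> C1 * 0 + C2 * 0 + 2 * (C1 * 0 + C2 * 0)\<^sup>2) at_top"
    by (intro tendsto_intros lims) real_asymp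
  moreover have "\<forall>\<^sub>F x in at_top. C1 * (N x * sqrt (1 / N x) / x) + C2 * (1 / x)
      + 2 * (C1 * (sqrt (N x / x) * sqrt (1 / N x)) + C2 * (sqrt (N x / x) * (x / N x)))\<^sup>2 = err x"
    using ev
  proof eventually_elim
    case (elim x)
    have "C1 * (sqrt (N x / x) * sqrt (1 / N x)) + C2 * (sqrt (N x / x) * (x / N x))
        = sqrt (N x / x) * Q x"
      by (simp add: Q_def algebra_simps)
    then show ?case
      using elim by (simp only: power_mult_distrib) (simp add: err_def field_simps)
  qed
  ultimately have err_lim: "(err \<longlongrightarrow> 0) at_top"
    by (simp add: tendsto_cong)
  have main_lim: "((\<lambda>x. (1 + (- C2) / real (N x)) ^ N x - err x) \<longlongrightarrow> exp (- C2)) at_top"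
    using tendsto_diff[OF exp_lim err_lim] by simp
  have "\<forall>\<^sub>F x in at_top. 1 / real (N x) < l"
    using lims(1) assms(1) by (rule order_tendstoD(2))
  moreover have "\<forall>\<^sub>F x in at_top. C2 / real (N x) < 1"
    using C2_lim by (rule order_tendstoD(2)) simp
  moreover have "\<forall>\<^sub>F x in at_top. Q x < 1 / 2"
    using Q_lim by (rule order_tendstoD(2)) simp
  moreover have "\<forall>\<^sub>F x in at_top. exp (- C2) - \<delta> < (1 + (- C2) / real (N x)) ^ N x - err x"
    using main_lim by (rule order_tendstoD(1)) (use assms in simp)
  ultimately show ?thesis
    using ev
  proof eventually_elim
    case (elim x)
    then have "(exp (- C2) - \<delta>) * x \<le> ((1 - C2 / N x) ^ N x - err x) * x"
      by (intro mult_right_mono) auto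
    also have "\<dots> = (1 - C2 / N x) ^ N x * x - err x * x"
      by (simp add: algebra_simps)
    also have "err x * x = N x * (C1 * sqrt (1 / N x) + C2 / N x + 2 * (Q x)\<^sup>2)"
      using elim by (simp add: err_def)
    finally show ?case
      using elim unfolding Q_def by (intro exI[of _ "N x"]) auto
  qed
qed

section \<open>Conclusion by a first-passage argument\<close>

theorem lemma3p1:
  fixes l C1 C2 \<delta> :: real
  assumes "l > 0" and "C1 \<ge> 0" and "C2 \<ge> 0"
    and "0 < \<delta>" and "\<delta> < exp (- C2)"
  shows "\<exists>\<eta>bar>0. \<forall>\<eta>. 0 < \<eta> \<and> \<eta> < 1 \<and> \<eta> < \<eta>bar \<longrightarrow>
           (\<forall>f :: real \<Rightarrow> 'a::real_normed_vector. f \<in> R_class \<eta> l C1 C2 \<longrightarrow>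
              sup_norm_on 0 1 f \<le> \<eta> powr (exp (- C2) - \<delta>))"
proof -
  define \<alpha> where "\<alpha> = exp (- C2) - \<delta>"
  have alpha: "0 < \<alpha>"
    using assms by (simp add: \<alpha>_def)
  obtain \<Lambda>0 where \<Lambda>0: "\<And>\<Lambda>. \<Lambda>0 \<le> \<Lambda> \<Longrightarrow> \<exists>N::nat. 0 < N \<and> 1 / N \<le> l \<and> C2 / N \<le> 1
    \<and> C1 * sqrt (1 / N) + C2 / N * \<Lambda> \<le> 1 / 2
    \<and> \<alpha> * \<Lambda> \<le> (1 - C2 / N) ^ N * \<Lambda>
        - N * (C1 * sqrt (1 / N) + C2 / N + 2 * (C1 * sqrt (1 / N) + C2 / N * \<Lambda>)\<^sup>2)"
    using eventually_grid_size[OF assms(1,4), of C2 C1]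
    unfolding eventually_at_top_linorder \<alpha>_def by blast
  show ?thesis
  \<comment> \<open>\<open>\<eta> < exp (- \<Lambda>0)\<close> says exactly that
    \<open>- ln \<eta>\<close> exceeds the threshold \<open>\<Lambda>0\<close>.\<close>
  proof (intro exI[of _ "exp (- \<Lambda>0)"] conjI allI impI)
    fix \<eta> and f :: "real \<Rightarrow> 'a"
    assume eta: "0 < \<eta> \<and> \<eta> < 1 \<and> \<eta> < exp (- \<Lambda>0)" and f: "f \<in> R_class \<eta> l C1 C2"
    have "ln \<eta> < ln (exp (- \<Lambda>0))"
      using eta by (subst ln_less_cancel_iff) auto
    then obtain N :: nat where N: "0 < N" "1 / N \<le> l" "C2 / N \<le> 1"
      "C1 * sqrt (1 / N) + C2 / N * (- ln \<eta>) \<le> 1 / 2"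
      and LN: "\<alpha> * (- ln \<eta>) \<le> (1 - C2 / N) ^ N * (- ln \<eta>)
        - N * (C1 * sqrt (1 / N) + C2 / N + 2 * (C1 * sqrt (1 / N) + C2 / N * (- ln \<eta>))\<^sup>2)"
      using \<Lambda>0[of "- ln \<eta>"] by auto
    \<comment> \<open>Together with \<open>LN\<close> this gives the nonnegative final exponent that
      \<open>R_class_growth\<close> requires.\<close>
    have "0 < \<alpha> * (- ln \<eta>)"
      using alpha eta by (intro mult_pos_pos) auto
    \<comment> \<open>Stated for a general \<tau> because it is applied twice: at the first passage
      time, and then at \<open>\<tau> = 1\<close>.\<close>
    have bound: "norm (f r) + \<eta> \<le> \<eta> powr \<alpha>"
      if "0 \<le> \<tau>" "\<tau> \<le> 1" "\<And>r. r \<in> {0..\<tau>} \<Longrightarrow> norm (f r) + \<eta> \<le> 1" "r \<in> {0..\<tau>}" for \<tau> r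
    proof -
      have "norm (f r) + \<eta> \<le> exp (- ((1 - C2 / N) ^ N * (- ln \<eta>)
        - N * (C1 * sqrt (1 / N) + C2 / N + 2 * (C1 * sqrt (1 / N) + C2 / N * (- ln \<eta>))\<^sup>2)))"
        using eta assms that N LN \<open>0 < \<alpha> * (- ln \<eta>)\<close>
        by (intro R_class_growth[OF f, of \<tau>]) auto
      also have "\<dots> \<le> exp (- (\<alpha> * (- ln \<eta>)))"
        using LN by simp
      also have "\<dots> = \<eta> powr \<alpha>"
        using eta by (simp add: powr_def)
      finally show ?thesis .
    qed
    have cont: "continuous_on {0..1} (\<lambda>r. norm (f r) + \<eta>)"
      using R_class_continuous_on[OF f] eta assms by (intro continuous_intros) auto
    have less_one: "norm (f r) + \<eta> < 1" if "r \<in> {0..1}" for r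
    proof (rule ccontr)
      define S where "S = {r \<in> {0..1}. 1 \<le> norm (f r) + \<eta>}"
      assume "\<not> norm (f r) + \<eta> < 1"
      then have "S \<noteq> {}"
        using that by (auto simp: S_def)
      moreover have "compact S"
        unfolding compact_eq_bounded_closed
      proof
        show "bounded S"
          by (rule bounded_subset[of "{0..1}"]) (auto simp: S_def)
        show "closed S"
          unfolding S_def by (intro continuous_on_closed_Collect_le continuous_on_const cont) auto
      qed
      ultimately obtain \<tau> where \<tau>: "\<tau> \<in> S" "\<And>t. t \<in> S \<Longrightarrow> \<tau> \<le> t"
        using compact_attains_inf by metis
      \<comment> \<open>Membership in \<open>S\<close> gives only \<open>\<ge> 1\<close> at \<tau>.
        The intermediate value theorem with minimality forces equality there, so
        \<open>bound\<close> applies on the closed interval up to \<tau>.\<close>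
      have "\<exists>x\<ge>0. x \<le> \<tau> \<and> norm (f x) + \<eta> = 1"
        using \<tau>(1) eta R_class_zero[OF f]
        by (intro IVT' continuous_on_subset[OF cont]) (auto simp: S_def)
      then obtain x where x: "0 \<le> x" "x \<le> \<tau>" "norm (f x) + \<eta> = 1"
        by blast
      then have "x \<in> S"
        using \<tau>(1) by (auto simp: S_def)
      then have "x = \<tau>"
        using \<tau>(2) x(2) by force
      have "norm (f r) + \<eta> \<le> 1" if r: "r \<in> {0..\<tau>}" for r
      proof (cases "r \<in> S")
        case True
        then show ?thesis
          using \<tau>(2)[of r] r x(3) \<open>x = \<tau>\<close> by auto
      next
        case False
        then show ?thesis
          using r \<tau>(1) by (auto simp: S_def)
      qed
      then have "norm (f \<tau>) + \<eta> \<le> \<eta> powr \<alpha>"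
        using \<tau>(1) by (intro bound[of \<tau>]) (auto simp: S_def)
      moreover have "\<eta> powr \<alpha> < 1"
        using powr_less_mono2[of \<alpha> \<eta> 1] eta alpha by simp
      ultimately show False
        using x(3) \<open>x = \<tau>\<close> by simp
    qed
    have "norm (f r) + \<eta> \<le> \<eta> powr \<alpha>" if "r \<in> {0..1}" for r
      using that less_one by (intro bound[of 1]) (auto intro: less_imp_le)
    then show "sup_norm_on 0 1 f \<le> \<eta> powr (exp (- C2) - \<delta>)"
      using eta by (intro sup_norm_on_le) (fastforce simp: \<alpha>_def)+
  qed simp
qed

end
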